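(* In the setting below, given an $\alpha_2$-approximate solution to $\mathcal{I}^2$, one can in polynomial time find a $4\alpha_2$-approximate solution to $\mathcal{I}^1$.
   Context: LBFL instance $(F,C,d,f,B)$: finite facilities $F$, clients $C$, a (pseudo)metric $d$ on $F\cup C$, costs $f_i \ge 0$, lower bounds $B_i\in\mathbb{Z}_{\ge0}$; a valid solution is $(S\subseteq F,\sigma \in S^C)$ with $|\{j:\sigma_j=i\}|\ge B_i$ for $i\in S$, of cost $\sum_{i\in S}f_i + \sum_j d(j,\sigma_j)$; an $\alpha$-approximate solution is a valid solution of cost at most $\alpha$ times the minimum. Setting: let $\mathcal{I} = (F,C,d,f,B)$ be an LBFL instance, $\beta\in(1/2,1)$, and $(S^\circ,\sigma^\circ)$ with $S^\circ\subseteq F$, $\sigma^\circ\in(S^\circ)^C$, $|\{j:\sigma^\circ_j=v\}|\ge\beta B_v$ for all $v\in S^\circ$, $\sigma^\circ_j$ a nearest point of $S^\circ$ to $j$, and cost at most $\frac{2}{1-\beta}$ times the optimum of $\mathcal{I}$; assume $|S^\circ|\ge 2$ and distinct points of $S^\circ$ are at positive distance. $\mathcal{I}^1 = (F,C,d^1,f^1,B)$ where $d^1(i,i') = d(i,i')$, $d^1(i,j) = d(i,\sigma^\circ_j)$, $d^1(j,j') = d(\sigma^\circ_j,\sigma^\circ_{j'})$ ($i,i'\in F$, $j,j'\in C$), $f^1_i = 0$ for $i\in S^\circ$ and $f^1_i = f_i$ otherwise. For $v\in S^\circ$: $n_v = |\{j: \sigma^\circ_j = v\}|$, $\ell_v =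 d(v,S^\circ\setminus\{v\})$, $N_v = \{i\in F: d(v,i)<\ell_v/2\}$ (disjoint sets). $\phi_i = v$ if $i\in N_v$, else $\phi_i = i$. $\mathcal{I}^2 = (F,C,d^2,f^2,B)$ where $d^2(i,i') = d^1(\phi_i,\phi_{i'})$, $d^2(i,j) = d^1(\phi_i,j)$, $d^2(j,j') = d^1(j,j')$, and $f^2_i = f^1_i + \frac{2}{3} n_v d^1(v,i)$ if $i\in N_v$ for some $v\in S^\circ$, $f^2_i = f^1_i$ otherwise. *)

theory Defs
  imports Complex_Main "HOL-Library.FuncSet" "HOL-Computational_Algebra.Polynomial"
begin

section \<open>Lower bounded facility location\<close>

text \<open>
  Points of the metric are \<open>Inl i\<close> for facilities and \<open>Inr j\<close> for clients. The derived
  distances below distinguish the two roles, so a location that is both a facility and a client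
  is represented by two points (at distance 0 from each other).
\<close>

definition pseudometric_on :: "'a set \<Rightarrow> ('a \<Rightarrow> 'a \<Rightarrow> real) \<Rightarrow> bool" where
  "pseudometric_on X d \<longleftrightarrow>
     (\<forall>x\<in>X. \<forall>y\<in>X. 0 \<le> d x y) \<and>
     (\<forall>x\<in>X. d x x = 0) \<and>
     (\<forall>x\<in>X. \<forall>y\<in>X. d x y = d y x) \<and>
     (\<forall>x\<in>X. \<forall>y\<in>X. \<forall>z\<in>X. d x z \<le> d x y + d y z)"

record ('f, 'c) lbfl =
  facilities :: "'f set"
  clients :: "'c set"
  distance :: "'f + 'c \<Rightarrow> 'f + 'c \<Rightarrow> real"
  open_cost :: "'f \<Rightarrow> real"
  lower :: "'f \<Rightarrow> nat"

definition lbfl_instance :: "('f, 'c) lbfl \<Rightarrow> bool" where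
  "lbfl_instance I \<longleftrightarrow>
     finite (facilities I) \<and> finite (clients I) \<and>
     pseudometric_on (facilities I <+> clients I) (distance I) \<and>
     (\<forall>i\<in>facilities I. 0 \<le> open_cost I i)"

definition valid_solution :: "('f, 'c) lbfl \<Rightarrow> 'f set \<times> ('c \<Rightarrow> 'f) \<Rightarrow> bool" where
  "valid_solution I = (\<lambda>(S, \<sigma>).
     S \<subseteq> facilities I \<and> \<sigma> \<in> clients I \<rightarrow>\<^sub>E S \<and>
     (\<forall>i\<in>S. lower I i \<le> card {j \<in> clients I. \<sigma> j = i}))"

definition solution_cost :: "('f, 'c) lbfl \<Rightarrow> 'f set \<times> ('c \<Rightarrow> 'f) \<Rightarrow> real" where
  "solution_cost I = (\<lambda>(S, \<sigma>).
     (\<Sum>i\<in>S. open_cost I i) + (\<Sum>j\<in>clients I. distance I (Inr j) (Inl (\<sigma> j))))"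

text \<open>
  For an instance there are only finitely many valid solutions; the value is meaningful
  only if there is at least one.
\<close>

definition optimum :: "('f, 'c) lbfl \<Rightarrow> real" where
  "optimum I = Min (solution_cost I ` {X. valid_solution I X})"

definition approx_solution :: "real \<Rightarrow> ('f, 'c) lbfl \<Rightarrow> 'f set \<times> ('c \<Rightarrow> 'f) \<Rightarrow> bool" where
  "approx_solution \<alpha> I X \<longleftrightarrow> valid_solution I X \<and> solution_cost I X \<le> \<alpha> * optimum I"


section \<open>The setting and the derived instances\<close>

definition setting :: "('f, 'c) lbfl \<Rightarrow> real \<Rightarrow> 'f set \<Rightarrow> ('c \<Rightarrow> 'f) \<Rightarrow> bool" where
  "setting I \<beta> So \<sigma>o \<longleftrightarrow>
     lbfl_instance I \<and> 1/2 < \<beta> \<and> \<beta> < 1 \<and>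
     So \<subseteq> facilities I \<and> \<sigma>o \<in> clients I \<rightarrow>\<^sub>E So \<and>
     (\<forall>v\<in>So. \<beta> * real (lower I v) \<le> real (card {j \<in> clients I. \<sigma>o j = v})) \<and>
     (\<forall>j\<in>clients I. \<forall>v\<in>So.
        distance I (Inr j) (Inl (\<sigma>o j)) \<le> distance I (Inr j) (Inl v)) \<and>
     solution_cost I (So, \<sigma>o) \<le> 2 / (1 - \<beta>) * optimum I \<and>
     2 \<le> card So \<and>
     (\<forall>u\<in>So. \<forall>v\<in>So. u \<noteq> v \<longrightarrow> 0 < distance I (Inl u) (Inl v))"

fun dist1 :: "('f, 'c) lbfl \<Rightarrow> ('c \<Rightarrow> 'f) \<Rightarrow> 'f + 'c \<Rightarrow> 'f + 'c \<Rightarrow> real" where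
  "dist1 I \<sigma>o (Inl i) (Inl i') = distance I (Inl i) (Inl i')"
| "dist1 I \<sigma>o (Inl i) (Inr j) = distance I (Inl i) (Inl (\<sigma>o j))"
| "dist1 I \<sigma>o (Inr j) (Inl i) = distance I (Inl i) (Inl (\<sigma>o j))"
| "dist1 I \<sigma>o (Inr j) (Inr j') = distance I (Inl (\<sigma>o j)) (Inl (\<sigma>o j'))"

definition open1 :: "('f, 'c) lbfl \<Rightarrow> 'f set \<Rightarrow> 'f \<Rightarrow> real" where
  "open1 I So i = (if i \<in> So then 0 else open_cost I i)"

definition inst1 :: "('f, 'c) lbfl \<Rightarrow> 'f set \<Rightarrow> ('c \<Rightarrow> 'f) \<Rightarrow> ('f, 'c) lbfl" where
  "inst1 I So \<sigma>o = I\<lparr>distance := dist1 I \<sigma>o, open_cost := open1 I So\<rparr>"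

definition nclients :: "('f, 'c) lbfl \<Rightarrow> ('c \<Rightarrow> 'f) \<Rightarrow> 'f \<Rightarrow> nat" where
  "nclients I \<sigma>o v = card {j \<in> clients I. \<sigma>o j = v}"

definition gap :: "('f, 'c) lbfl \<Rightarrow> 'f set \<Rightarrow> 'f \<Rightarrow> real" where
  "gap I So v = Min ((\<lambda>u. distance I (Inl v) (Inl u)) ` (So - {v}))"

definition nbhd :: "('f, 'c) lbfl \<Rightarrow> 'f set \<Rightarrow> 'f \<Rightarrow> 'f set" where
  "nbhd I So v = {i \<in> facilities I. distance I (Inl v) (Inl i) < gap I So v / 2}"

text \<open>The sets \<open>nbhd I So v\<close>, \<open>v \<in> So\<close>, are disjoint, so the following choice is unique.\<close>

definition center :: "('f, 'c) lbfl \<Rightarrow> 'f set \<Rightarrow> 'f \<Rightarrow> 'f" where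
  "center I So i =
     (if \<exists>v\<in>So. i \<in> nbhd I So v then THE v. v \<in> So \<and> i \<in> nbhd I So v else i)"

fun dist2 :: "('f, 'c) lbfl \<Rightarrow> 'f set \<Rightarrow> ('c \<Rightarrow> 'f) \<Rightarrow> 'f + 'c \<Rightarrow> 'f + 'c \<Rightarrow> real" where
  "dist2 I So \<sigma>o (Inl i) (Inl i') = dist1 I \<sigma>o (Inl (center I So i)) (Inl (center I So i'))"
| "dist2 I So \<sigma>o (Inl i) (Inr j) = dist1 I \<sigma>o (Inl (center I So i)) (Inr j)"
| "dist2 I So \<sigma>o (Inr j) (Inl i) = dist1 I \<sigma>o (Inl (center I So i)) (Inr j)"
| "dist2 I So \<sigma>o (Inr j) (Inr j') = dist1 I \<sigma>o (Inr j) (Inr j')"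

definition open2 :: "('f, 'c) lbfl \<Rightarrow> 'f set \<Rightarrow> ('c \<Rightarrow> 'f) \<Rightarrow> 'f \<Rightarrow> real" where
  "open2 I So \<sigma>o i =
     (if \<exists>v\<in>So. i \<in> nbhd I So v
      then open1 I So i + 2/3 * real (nclients I \<sigma>o (center I So i))
             * dist1 I \<sigma>o (Inl (center I So i)) (Inl i)
      else open1 I So i)"

definition inst2 :: "('f, 'c) lbfl \<Rightarrow> 'f set \<Rightarrow> ('c \<Rightarrow> 'f) \<Rightarrow> ('f, 'c) lbfl" where
  "inst2 I So \<sigma>o = I\<lparr>distance := dist2 I So \<sigma>o, open_cost := open2 I So \<sigma>o\<rparr>"


section \<open>Machine model\<close>

text \<open>
  Running time is measured on a random access machine, presented as a while language. Its memory
  consists of unbounded two-dimensional arrays of natural numbers (also used as indices) and of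
  real numbers. Assignments, tests and \<open>SKIP\<close> cost one step each; expressions have a size fixed
  by the program, so charging for their evaluation would change running times only by a constant
  factor.

  The arithmetic is deliberately restricted to addition, subtraction and comparison: there is no
  multiplication, no rounding of reals to naturals and no real constant besides those obtained
  from naturals. Bit lengths therefore grow by at most a constant per step (take rational data over
  a common denominator), and a polynomial number of steps amounts to polynomial time on a Turing
  machine.
\<close>

datatype nexp =
    NConst nat
  | NGet string nexp nexp
  | NAdd nexp nexp
  | NSub nexp nexp

datatype rexp =
    ROfNat nexp
  | RGet string nexp nexp
  | RAdd rexp rexp
  | RSub rexp rexp

datatype bexp =
    NLess nexp nexp
  | RLess rexp rexp
  | Neg bexp
  | Conj bexp bexp

datatype com =
    SKIP
  | NPut string nexp nexp nexp
  | RPut string nexp nexp rexp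
  | Seq com com
  | If bexp com com
  | While bexp com

record state =
  nmem :: "string \<times> nat \<times> nat \<Rightarrow> nat"
  rmem :: "string \<times> nat \<times> nat \<Rightarrow> real"

fun nval :: "nexp \<Rightarrow> state \<Rightarrow> nat" where
  "nval (NConst n) s = n"
| "nval (NGet x a b) s = nmem s (x, nval a s, nval b s)"
| "nval (NAdd a b) s = nval a s + nval b s"
| "nval (NSub a b) s = nval a s - nval b s"

fun rval :: "rexp \<Rightarrow> state \<Rightarrow> real" where
  "rval (ROfNat a) s = real (nval a s)"
| "rval (RGet x a b) s = rmem s (x, nval a s, nval b s)"
| "rval (RAdd a b) s = rval a s + rval b s"
| "rval (RSub a b) s = rval a s - rval b s"

fun bval :: "bexp \<Rightarrow> state \<Rightarrow> bool" where
  "bval (NLess a b) s \<longleftrightarrow> nval a s < nval b s"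
| "bval (RLess a b) s \<longleftrightarrow> rval a s < rval b s"
| "bval (Neg p) s \<longleftrightarrow> \<not> bval p s"
| "bval (Conj p q) s \<longleftrightarrow> bval p s \<and> bval q s"

text \<open>\<open>exec c s t s'\<close>: started in \<open>s\<close>, program \<open>c\<close> halts after exactly \<open>t\<close> steps in \<open>s'\<close>.\<close>

inductive exec :: "com \<Rightarrow> state \<Rightarrow> nat \<Rightarrow> state \<Rightarrow> bool" where
  Skip: "exec SKIP s 1 s"
| NPut: "exec (NPut x a b e) s 1
           (s\<lparr>nmem := (nmem s)((x, nval a s, nval b s) := nval e s)\<rparr>)"
| RPut: "exec (RPut x a b e) s 1
           (s\<lparr>rmem := (rmem s)((x, nval a s, nval b s) := rval e s)\<rparr>)"
| Seq: "exec c1 s t1 s' \<Longrightarrow> exec c2 s' t2 s'' \<Longrightarrow> exec (Seq c1 c2) s (t1 + t2) s''"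
| IfTrue: "bval p s \<Longrightarrow> exec c1 s t s' \<Longrightarrow> exec (If p c1 c2) s (1 + t) s'"
| IfFalse: "\<not> bval p s \<Longrightarrow> exec c2 s t s' \<Longrightarrow> exec (If p c1 c2) s (1 + t) s'"
| WhileFalse: "\<not> bval p s \<Longrightarrow> exec (While p c) s 1 s"
| WhileTrue: "bval p s \<Longrightarrow> exec c s t1 s' \<Longrightarrow> exec (While p c) s' t2 s'' \<Longrightarrow>
                exec (While p c) s (1 + t1 + t2) s''"


section \<open>Representation of inputs and outputs in memory\<close>

text \<open>
  Relative to enumerations \<open>fs\<close> of the facilities and \<open>cs\<close> of the clients, facility \<open>fs ! k\<close> is
  point \<open>k\<close> and client \<open>cs ! k\<close> is point \<open>length fs + k\<close> of the distance matrix. Nothing is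
  assumed about memory cells that are not mentioned.
\<close>

definition enumerates :: "'a list \<Rightarrow> 'a set \<Rightarrow> bool" where
  "enumerates xs X \<longleftrightarrow> distinct xs \<and> set xs = X"

definition stores_instance ::
    "'f list \<Rightarrow> 'c list \<Rightarrow> ('f, 'c) lbfl \<Rightarrow> state \<Rightarrow> bool" where
  "stores_instance fs cs I s \<longleftrightarrow>
     nmem s (''nF'', 0, 0) = length fs \<and>
     nmem s (''nC'', 0, 0) = length cs \<and>
     (let ps = map Inl fs @ map Inr cs in
        \<forall>a<length ps. \<forall>b<length ps. rmem s (''d'', a, b) = distance I (ps ! a) (ps ! b)) \<and>
     (\<forall>k<length fs. rmem s (''f'', k, 0) = open_cost I (fs ! k)) \<and>
     (\<forall>k<length fs. nmem s (''B'', k, 0) = lower I (fs ! k))"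

text \<open>
  Array \<open>x\<close> holds the characteristic vector of \<open>S\<close>, and array \<open>y\<close> the index in \<open>fs\<close> of the
  facility assigned to each client.
\<close>

definition stores_solution ::
    "string \<Rightarrow> string \<Rightarrow> 'f list \<Rightarrow> 'c list \<Rightarrow> 'f set \<times> ('c \<Rightarrow> 'f) \<Rightarrow> state \<Rightarrow> bool" where
  "stores_solution x y fs cs = (\<lambda>(S, \<sigma>) s.
     (\<forall>k<length fs. nmem s (x, k, 0) = of_bool (fs ! k \<in> S)) \<and>
     (\<forall>k<length cs. nmem s (y, k, 0) < length fs \<and> fs ! nmem s (y, k, 0) = \<sigma> (cs ! k)))"

end

theory Submission
  imports Defs
begin

text \<open>
  The given solution itself is returned, so the program only copies two arrays.

  Write \<open>c i\<close> for the center of \<open>i\<close>. Spreading the surcharge \<open>2/3 n\<^sub>v d(v, i)\<close> over the clients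
  at \<open>v\<close>, each client pays \<open>d(c (\<sigma> j), v) + 2/3 \<Sum> d(v, i)\<close> in the second instance, the sum
  ranging over the open \<open>i\<close> with center \<open>v\<close>. Comparing client by client, the cost in the first
  instance is at most \<open>3/2\<close> times the cost in the second. Conversely, from an optimal solution of
  the first instance close all facilities of each \<open>N\<^sub>v\<close> except the one closest to \<open>v\<close>, which takes
  over their clients; the sum above then has at most one term, and every client pays at most \<open>8/3\<close>
  of its former connection cost. Finally \<open>3/2 \<cdot> 8/3 = 4\<close>.
\<close>

section \<open>Optimal solutions\<close>

lemma finite_valid_solutions:
  assumes "finite (facilities I)" "finite (clients I)"
  shows "finite {X. valid_solution I X}"
proof (rule finite_subset)
  show "{X. valid_solution I X} \<subseteq>
      Sigma (Pow (facilities I)) (\<lambda>S. clients I \<rightarrow>\<^sub>E S)"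
    by (auto simp: valid_solution_def)
  show "finite (Sigma (Pow (facilities I)) (\<lambda>S. clients I \<rightarrow>\<^sub>E S))"
    using assms by (auto intro!: finite_SigmaI finite_PiE intro: finite_subset)
qed

lemma optimum_le:
  assumes "finite (facilities I)" "finite (clients I)" "valid_solution I X"
  shows "optimum I \<le> solution_cost I X"
  unfolding optimum_def using finite_valid_solutions[OF assms(1,2)] assms(3) by (auto intro!: Min_le)

text \<open>The valid solution \<open>X\<close> makes the finite set under \<open>Min\<close>
  nonempty, so the minimum is attained.\<close>

lemma optimum_attained:
  assumes "finite (facilities I)" "finite (clients I)" "valid_solution I X"
  obtains Y where "valid_solution I Y" "solution_cost I Y = optimum I"
proof -
  have "optimum I \<in> solution_cost I ` {X. valid_solution I X}"
    unfolding optimum_def using finite_valid_solutions[OF assms(1,2)] assms(3)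
    by (intro Min_in) blast+
  then show ?thesis using that by auto
qed

section \<open>Costs in the two derived instances\<close>

locale lbfl_setting =
  fixes I :: "('f, 'c) lbfl" and \<beta> :: real and So :: "'f set" and \<sigma>o :: "'c \<Rightarrow> 'f"
  assumes setting: "setting I \<beta> So \<sigma>o"
begin

abbreviation F where "F \<equiv> facilities I"
abbreviation C where "C \<equiv> clients I"
abbreviation d where "d i k \<equiv> distance I (Inl i) (Inl k)"
abbreviation c where "c \<equiv> center I So"
abbreviation I1 where "I1 \<equiv> inst1 I So \<sigma>o"
abbreviation I2 where "I2 \<equiv> inst2 I So \<sigma>o"

lemma finite_F: "finite F" and finite_C: "finite C"
  and So_subset: "So \<subseteq> F" and card_So: "2 \<le> card So"
  and \<sigma>o_in: "j \<in> C \<Longrightarrow> \<sigma>o j \<in> So"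
  and open_cost_nonneg: "i \<in> F \<Longrightarrow> 0 \<le> open_cost I i"
  and d_pos: "u \<in> So \<Longrightarrow> v \<in> So \<Longrightarrow> u \<noteq> v \<Longrightarrow> 0 < d u v"
  using setting by (auto simp: setting_def lbfl_instance_def)

lemma pseudometric: "pseudometric_on (F <+> C) (distance I)"
  using setting by (auto simp: setting_def lbfl_instance_def)

lemma d_nonneg: "i \<in> F \<Longrightarrow> k \<in> F \<Longrightarrow> 0 \<le> d i k"
  and d_refl: "i \<in> F \<Longrightarrow> d i i = 0"
  and d_sym: "i \<in> F \<Longrightarrow> k \<in> F \<Longrightarrow> d i k = d k i"
  and d_triangle: "i \<in> F \<Longrightarrow> k \<in> F \<Longrightarrow> l \<in> F \<Longrightarrow> d i l \<le> d i k + d k l"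
  using pseudometric unfolding pseudometric_on_def by blast+

lemma finite_So: "finite So"
  using So_subset finite_F by (rule finite_subset)

section \<open>Disjoint neighbourhoods and the center map\<close>

lemma gap_le:
  assumes "u \<in> So" "v \<in> So" "u \<noteq> v"
  shows "gap I So v \<le> d v u"
  unfolding gap_def using assms finite_So by (intro Min_le) auto

lemma gap_pos:
  assumes "v \<in> So"
  shows "0 < gap I So v"
proof -
  have "card (So - {v}) \<noteq> 0"
    using card_So card_Diff_singleton[OF assms] by simp
  then have "So - {v} \<noteq> {}" by (metis card.empty)
  then show ?thesis
    unfolding gap_def using finite_So assms d_pos by (subst Min_gr_iff) auto
qed

text \<open>A common point would put \<open>u\<close> and \<open>v\<close> at distance less than the
  mean of their gaps, yet each gap is at most \<open>d u v\<close>.\<close>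

lemma nbhd_unique:
  assumes "u \<in> So" "v \<in> So" "i \<in> nbhd I So u" "i \<in> nbhd I So v"
  shows "u = v"
proof (rule ccontr)
  assume ne: "u \<noteq> v"
  have F: "u \<in> F" "v \<in> F" "i \<in> F"
    using assms So_subset by (auto simp: nbhd_def)
  have "d u v \<le> d u i + d v i"
    using d_triangle[of u i v] d_sym[of v i] F by auto
  moreover have "d u i < gap I So u / 2" "d v i < gap I So v / 2"
    using assms by (auto simp: nbhd_def)
  ultimately show False
    using gap_le[of u v] gap_le[of v u] d_sym[of u v] F ne assms by auto
qed

lemma center_eq:
  assumes "v \<in> So" "i \<in> nbhd I So v"
  shows "c i = v"
proof -
  have "(THE v. v \<in> So \<and> i \<in> nbhd I So v) = v"
    using assms nbhd_unique by blast
  then show ?thesis using assms unfolding center_def by auto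
qed

lemma center_cases:
  obtains (inside) "c i \<in> So" "i \<in> nbhd I So (c i)"
  | (outside) "\<And>v. v \<in> So \<Longrightarrow> i \<notin> nbhd I So v" "c i = i"
proof (cases "\<exists>v\<in>So. i \<in> nbhd I So v")
  case True
  then show ?thesis using inside center_eq by metis
next
  case False
  then show ?thesis using outside by (auto simp: center_def)
qed

lemma center_in_F: "i \<in> F \<Longrightarrow> c i \<in> F"
  using So_subset by (cases i rule: center_cases) auto

lemma self_in_nbhd: "v \<in> So \<Longrightarrow> v \<in> nbhd I So v"
  using gap_pos[of v] So_subset d_refl[of v] by (auto simp: nbhd_def)

text \<open>A facility outside all neighbourhoods is its own center, and it is not in
  \<open>So\<close> because each point of \<open>So\<close> lies in its own neighbourhood.\<close>

lemma center_eq_SoD: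
  assumes "v \<in> So" "c i = v"
  shows "i \<in> nbhd I So v"
  using assms self_in_nbhd by (cases i rule: center_cases) auto

lemma open1_nonneg: "i \<in> F \<Longrightarrow> 0 \<le> open1 I So i"
  using open_cost_nonneg by (auto simp: open1_def)

lemma open2_eq:
  assumes "i \<in> F"
  shows "open2 I So \<sigma>o i =
    open1 I So i + 2/3 * real (nclients I \<sigma>o (c i)) * d (c i) i"
proof (cases i rule: center_cases)
  case inside
  then show ?thesis by (auto simp: open2_def)
next
  case outside
  then show ?thesis using assms d_refl by (auto simp: open2_def)
qed

section \<open>Effect on distances of moving a facility to its center\<close>

lemma center_dist_le:
  assumes "i \<in> F" "v \<in> So" "c i \<noteq> v"
  shows "d (c i) i \<le> d (c i) v / 2"
proof (cases i rule: center_cases)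
  \<comment> \<open>Here \<open>i\<close> is within half the gap of its center, and that gap is at
    most the distance to the other point \<open>v\<close>.\<close>
  case inside
  then show ?thesis using gap_le[of v "c i"] assms by (auto simp: nbhd_def)
next
  case outside
  then show ?thesis using d_refl[of i] d_nonneg[of i v] assms So_subset by auto
qed

text \<open>On the way from \<open>i\<close> to \<open>v\<close> through \<open>c i\<close>, the
  first leg is at most half of the second.\<close>

lemma dist1_le:
  assumes "i \<in> F" "v \<in> So" "c i \<noteq> v"
  shows "d i v \<le> 3/2 * d (c i) v"
  using center_dist_le[OF assms] d_triangle[of i "c i" v] d_sym[of i "c i"] assms
    center_in_F[of i] So_subset by auto

text \<open>The triangle inequality through \<open>i\<close> bounds \<open>d (c i) v\<close> by
  \<open>d (c i) v / 2 + d i v\<close>; solving for \<open>d (c i) v\<close> gives the factor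
  2.\<close>

lemma dist2_le:
  assumes "i \<in> F" "v \<in> So"
  shows "d (c i) v \<le> 2 * d i v"
proof (cases "c i = v")
  case True
  then show ?thesis using assms d_refl[of v] d_nonneg[of i v] So_subset by auto
next
  case False
  then show ?thesis
    using center_dist_le[OF assms False] d_triangle[of "c i" i v] assms
      center_in_F[of i] So_subset by auto
qed

text \<open>This covers a client at \<open>v\<close> served from another center: it bears its share
  of the surcharge of a facility \<open>k\<close> near \<open>v\<close> besides its own
  connection.\<close>

lemma surcharge_plus_dist2_le:
  assumes "i \<in> F" "k \<in> F" "v \<in> So" "c k = v" "c i \<noteq> v"
  shows "2/3 * d v k + d (c i) v \<le> 8/3 * d i v"
proof (cases i rule: center_cases)
  \<comment> \<open>Here \<open>d v k\<close> is at most half of \<open>d (c i) v\<close>, so the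
    left side is at most 4/3 times \<open>d (c i) v\<close>, and \<open>dist2_le\<close> turns this
    into 8/3.\<close>
  case inside
  have "d v k < gap I So v / 2"
    using center_eq_SoD[of v k] assms by (auto simp: nbhd_def)
  also have "\<dots> \<le> d (c i) v / 2"
    using gap_le[of "c i" v] inside assms d_sym[of v "c i"] So_subset
    by (auto simp: subset_iff)
  finally show ?thesis using dist2_le[of i v] assms by auto
next
  \<comment> \<open>Now \<open>i\<close> is at least half the gap away from \<open>v\<close> while
    \<open>k\<close> is closer, so already 5/3 times \<open>d i v\<close> suffices.\<close>
  case outside
  have "d v k < gap I So v / 2"
    using center_eq_SoD[of v k] assms by (auto simp: nbhd_def)
  also have "\<dots> \<le> d i v"
    using outside(1)[of v] assms d_sym[of v i] So_subset by (auto simp: nbhd_def)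
  finally show ?thesis
    using outside d_nonneg[of i v] assms So_subset by auto
qed

section \<open>Costs written client by client\<close>

lemma valid_inst1: "valid_solution I1 = valid_solution I"
  and valid_inst2: "valid_solution I2 = valid_solution I"
  by (auto simp: inst1_def inst2_def valid_solution_def)

lemma solution_cost_inst1:
  "solution_cost I1 (S, \<sigma>) =
    (\<Sum>i\<in>S. open1 I So i) + (\<Sum>j\<in>C. d (\<sigma> j) (\<sigma>o j))"
  by (simp add: solution_cost_def inst1_def)

text \<open>Double counting: \<open>nclients\<close> at \<open>c i\<close> is the number of clients
  \<open>j\<close> with \<open>\<sigma>o j = c i\<close>, so each of them is charged
  \<open>2/3 * d (c i) i\<close> once.\<close>

lemma solution_cost_inst2:
  assumes "valid_solution I (S, \<sigma>)"
  shows "solution_cost I2 (S, \<sigma>) = (\<Sum>i\<in>S. open1 I So i) +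
    (\<Sum>j\<in>C. 2/3 * (\<Sum>i\<in>{i\<in>S. c i = \<sigma>o j}. d (\<sigma>o j) i) + d (c (\<sigma> j)) (\<sigma>o j))"
proof -
  have S: "S \<subseteq> F" "finite S"
    using assms finite_F by (auto simp: valid_solution_def intro: finite_subset)
  have "(\<Sum>i\<in>S. 2/3 * real (nclients I \<sigma>o (c i)) * d (c i) i) =
      (\<Sum>i\<in>S. \<Sum>j\<in>{j\<in>C. c i = \<sigma>o j}. 2/3 * d (\<sigma>o j) i)"
  proof (rule sum.cong)
    fix i
    have "(\<Sum>j\<in>{j\<in>C. c i = \<sigma>o j}. 2/3 * d (\<sigma>o j) i) =
        (\<Sum>j\<in>{j\<in>C. \<sigma>o j = c i}. 2/3 * d (c i) i)"
      by (rule sum.cong) auto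
    then show "2/3 * real (nclients I \<sigma>o (c i)) * d (c i) i =
        (\<Sum>j\<in>{j\<in>C. c i = \<sigma>o j}. 2/3 * d (\<sigma>o j) i)"
      by (simp add: nclients_def)
  qed simp
  also have "\<dots> = (\<Sum>j\<in>C. \<Sum>i\<in>{i\<in>S. c i = \<sigma>o j}. 2/3 * d (\<sigma>o j) i)"
    using S(2) finite_C by (rule sum.swap_restrict)
  finally have surcharge: "(\<Sum>i\<in>S. 2/3 * real (nclients I \<sigma>o (c i)) * d (c i) i) =
      (\<Sum>j\<in>C. 2/3 * (\<Sum>i\<in>{i\<in>S. c i = \<sigma>o j}. d (\<sigma>o j) i))"
    by (simp only: sum_distrib_left)
  have "(\<Sum>i\<in>S. open2 I So \<sigma>o i) =
      (\<Sum>i\<in>S. open1 I So i + 2/3 * real (nclients I \<sigma>o (c i)) * d (c i) i)"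
    using S by (intro sum.cong) (auto simp: open2_eq)
  with surcharge show ?thesis
    by (simp add: solution_cost_def inst2_def sum.distrib)
qed

lemma solution_cost_inst1_nonneg:
  assumes "valid_solution I (S, \<sigma>)"
  shows "0 \<le> solution_cost I1 (S, \<sigma>)"
proof -
  have "S \<subseteq> F" "\<And>j. j \<in> C \<Longrightarrow> \<sigma> j \<in> F"
    using assms by (auto simp: valid_solution_def)
  then show ?thesis
    unfolding solution_cost_inst1
    using \<sigma>o_in So_subset by (intro add_nonneg_nonneg sum_nonneg d_nonneg open1_nonneg) auto
qed

lemma solution_cost_inst1_le:
  assumes "valid_solution I (S, \<sigma>)"
  shows "solution_cost I1 (S, \<sigma>) \<le> 3/2 * solution_cost I2 (S, \<sigma>)"
proof -
  have S: "S \<subseteq> F" "finite S" and \<sigma>: "\<And>j. j \<in> C \<Longrightarrow> \<sigma> j \<in> S"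
    using assms finite_F by (auto simp: valid_solution_def intro: finite_subset)
  have client: "d (\<sigma> j) (\<sigma>o j) \<le>
      3/2 * (2/3 * (\<Sum>i\<in>{i\<in>S. c i = \<sigma>o j}. d (\<sigma>o j) i) + d (c (\<sigma> j)) (\<sigma>o j))"
    if j: "j \<in> C" for j
  proof -
    let ?A = "{i\<in>S. c i = \<sigma>o j}"
    have F: "\<sigma> j \<in> F" "\<sigma>o j \<in> F" "\<sigma>o j \<in> So" using \<sigma> S \<sigma>o_in So_subset j by auto
    have A: "finite ?A" "\<And>i. i \<in> ?A \<Longrightarrow> 0 \<le> d (\<sigma>o j) i"
      using S F d_nonneg by auto
    show ?thesis
    proof (cases "c (\<sigma> j) = \<sigma>o j")
      \<comment> \<open>The connection is free in the second instance, but \<open>\<sigma> j\<close>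
        contributes a term to the surcharge sum, and 3/2 times 2/3 is 1.\<close>
      case True
      then have "d (\<sigma>o j) (\<sigma> j) \<le> (\<Sum>i\<in>?A. d (\<sigma>o j) i)"
        using A \<sigma>[OF j] by (intro member_le_sum) auto
      then show ?thesis using d_sym[OF F(1,2)] d_refl[OF F(2)] True by simp
    next
      case False
      have "0 \<le> (\<Sum>i\<in>?A. d (\<sigma>o j) i)" using A by (intro sum_nonneg) auto
      then show ?thesis using dist1_le[OF F(1,3) False] by argo
    qed
  qed
  have "0 \<le> (\<Sum>i\<in>S. open1 I So i)"
    using S open1_nonneg by (intro sum_nonneg) auto
  moreover have "(\<Sum>j\<in>C. d (\<sigma> j) (\<sigma>o j)) \<le> 3/2 *
      (\<Sum>j\<in>C. 2/3 * (\<Sum>i\<in>{i\<in>S. c i = \<sigma>o j}. d (\<sigma>o j) i) + d (c (\<sigma> j)) (\<sigma>o j))"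
    by (subst sum_distrib_left) (intro sum_mono client)
  ultimately show ?thesis
    unfolding solution_cost_inst1 solution_cost_inst2[OF assms] distrib_left
    by argo
qed

text \<open>Applied to an optimal solution of the first instance, this bounds the optimum of the
  second.\<close>

lemma consolidated_solution:
  assumes valid: "valid_solution I (S, \<sigma>)"
  obtains T \<tau> where "valid_solution I (T, \<tau>)"
    "solution_cost I2 (T, \<tau>) \<le> 8/3 * solution_cost I1 (S, \<sigma>)"
proof -
  have S: "S \<subseteq> F" "finite S" and \<sigma>: "\<And>j. j \<in> C \<Longrightarrow> \<sigma> j \<in> S"
    and lower: "\<And>i. i \<in> S \<Longrightarrow> lower I i \<le> card {j\<in>C. \<sigma> j = i}"
    using valid finite_F by (auto simp: valid_solution_def intro: finite_subset)
  \<comment> \<open>Among the open facilities with center \<open>u\<close>, the nearest one has the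
    least surcharge distance. A facility outside all neighbourhoods is alone in its class and stays
    open.\<close>
  define r where "r u = (ARG_MIN (d u) k. k \<in> S \<and> c k = u)" for u
  have r: "r (c i) \<in> S" "c (r (c i)) = c i" "d (c i) (r (c i)) \<le> d (c i) i" if "i \<in> S" for i
  proof -
    let ?A = "{k. k \<in> S \<and> c k = c i}"
    have A: "finite ?A" "?A \<noteq> {}" using S that by auto
    have eq: "r (c i) = arg_min_on (d (c i)) ?A"
      by (simp add: r_def arg_min_on_def)
    show "r (c i) \<in> S" "c (r (c i)) = c i"
      using arg_min_if_finite(1)[OF A, of "d (c i)"] by (auto simp: eq)
    show "d (c i) (r (c i)) \<le> d (c i) i"
      unfolding eq using A that by (intro arg_min_least) auto
  qed
  define T where "T = {i\<in>S. r (c i) = i}"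
  define \<tau> where "\<tau> = (\<lambda>j\<in>C. r (c (\<sigma> j)))"
  \<comment> \<open>Reassignment keeps the center, so connection distances in the second instance do
    not change.\<close>
  have \<tau>: "\<tau> j \<in> T" "c (\<tau> j) = c (\<sigma> j)" if "j \<in> C" for j
    using r \<sigma> that by (auto simp: T_def \<tau>_def)
  have valid': "valid_solution I (T, \<tau>)"
  proof -
    have "lower I i \<le> card {j\<in>C. \<tau> j = i}" if i: "i \<in> T" for i
    proof -
      \<comment> \<open>A kept facility retains all its clients, so its lower bound
        survives.\<close>
      have "{j\<in>C. \<sigma> j = i} \<subseteq> {j\<in>C. \<tau> j = i}" using i by (auto simp: T_def \<tau>_def)
      then have "card {j\<in>C. \<sigma> j = i} \<le> card {j\<in>C. \<tau> j = i}"
        using finite_C by (intro card_mono) auto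
      then show ?thesis using lower[of i] i by (auto simp: T_def)
    qed
    moreover have "\<tau> \<in> C \<rightarrow>\<^sub>E T" using \<tau> by (auto simp: \<tau>_def)
    ultimately show ?thesis using S by (auto simp: valid_solution_def T_def)
  qed
  have client: "2/3 * (\<Sum>i\<in>{i\<in>T. c i = \<sigma>o j}. d (\<sigma>o j) i) + d (c (\<tau> j)) (\<sigma>o j) \<le>
      8/3 * d (\<sigma> j) (\<sigma>o j)" if j: "j \<in> C" for j
  proof -
    let ?A = "{i\<in>T. c i = \<sigma>o j}"
    have F: "\<sigma> j \<in> F" "\<sigma>o j \<in> F" "\<sigma>o j \<in> So" using \<sigma> S \<sigma>o_in So_subset j by auto
    have nonneg: "0 \<le> d (\<sigma> j) (\<sigma>o j)" using d_nonneg F by auto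
    \<comment> \<open>An element of \<open>T\<close> is recovered from its center by
      \<open>r\<close>, so \<open>?A\<close> has at most one element.\<close>
    consider "?A = {}" | i where "i \<in> T" "c i = \<sigma>o j" by auto
    then show ?thesis
    proof cases
      case 1
      then have "(\<Sum>i\<in>?A. d (\<sigma>o j) i) = 0" by (simp only: sum.empty)
      then show ?thesis using dist2_le[OF F(1,3)] nonneg \<tau>(2)[OF j] by simp
    next
      case 2
      have "?A = {i}" using 2 by (auto simp: T_def)
      then have sum: "(\<Sum>i\<in>?A. d (\<sigma>o j) i) = d (\<sigma>o j) i" by simp
      show ?thesis
      proof (cases "c (\<sigma> j) = \<sigma>o j")
        \<comment> \<open>The client pays only surcharge, and the kept facility is no farther from
          \<open>\<sigma>o j\<close> than \<open>\<sigma> j\<close> is.\<close>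
        case True
        have "d (\<sigma>o j) i \<le> d (\<sigma>o j) (\<sigma> j)"
          using r(3)[of "\<sigma> j"] \<sigma>[OF j] 2 True by (auto simp: T_def)
        then show ?thesis
          using d_sym[OF F(1,2)] d_refl[OF F(2)] True \<tau>(2)[OF j] nonneg sum by simp
      next
        case False
        then show ?thesis
          using surcharge_plus_dist2_le[OF F(1) _ F(3) 2(2) False] 2 S sum \<tau>(2)[OF j]
          by (auto simp: T_def)
      qed
    qed
  qed
  have "(\<Sum>i\<in>T. open1 I So i) \<le> (\<Sum>i\<in>S. open1 I So i)"
    using S open1_nonneg by (intro sum_mono2) (auto simp: T_def)
  moreover have "0 \<le> (\<Sum>i\<in>S. open1 I So i)"
    using S open1_nonneg by (intro sum_nonneg) auto
  moreover have "(\<Sum>j\<in>C. 2/3 * (\<Sum>i\<in>{i\<in>T. c i = \<sigma>o j}. d (\<sigma>o j) i) + d (c (\<tau> j)) (\<sigma>o j)) \<le>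
      8/3 * (\<Sum>j\<in>C. d (\<sigma> j) (\<sigma>o j))"
    unfolding sum_distrib_left[of "8/3"] by (intro sum_mono client)
  ultimately have "solution_cost I2 (T, \<tau>) \<le> 8/3 * solution_cost I1 (S, \<sigma>)"
    unfolding solution_cost_inst1 solution_cost_inst2[OF valid'] distrib_left
    by argo
  with valid' that show ?thesis by blast
qed

text \<open>The cost in the first instance is at most 3/2 of that in the second, hence at most
  \<open>3/2 * \<alpha>\<close> times the second optimum, which is at most 8/3 of the first.\<close>

lemma approx_solution_inst1:
  assumes "approx_solution \<alpha> I2 (S, \<sigma>)"
  shows "approx_solution (4 * \<alpha>) I1 (S, \<sigma>)"
proof -
  have valid: "valid_solution I (S, \<sigma>)" and cost: "solution_cost I2 (S, \<sigma>) \<le> \<alpha> * optimum I2"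
    using assms by (auto simp: approx_solution_def valid_inst2)
  have fin: "finite (facilities I1)" "finite (clients I1)"
    "finite (facilities I2)" "finite (clients I2)"
    using finite_F finite_C by (auto simp: inst1_def inst2_def)
  obtain Y where Y: "valid_solution I Y" "solution_cost I1 Y = optimum I1"
    using optimum_attained[OF fin(1,2)] valid valid_inst1 by metis
  obtain X where X: "valid_solution I X" "solution_cost I2 X = optimum I2"
    using optimum_attained[OF fin(3,4)] valid valid_inst2 by metis
  obtain Z where "valid_solution I Z" "solution_cost I2 Z \<le> 8/3 * optimum I1"
    using consolidated_solution Y by (metis surj_pair)
  then have opt: "optimum I2 \<le> 8/3 * optimum I1"
    using optimum_le[OF fin(3,4), of Z] valid_inst2 by auto
  have nonneg1: "0 \<le> optimum I1"
    using solution_cost_inst1_nonneg Y by (metis surj_pair)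
  \<comment> \<open>An optimal solution of the second instance costs at least 2/3 of its nonnegative
    cost in the first.\<close>
  have nonneg2: "0 \<le> optimum I2"
    using solution_cost_inst1_nonneg[of "fst X" "snd X"] solution_cost_inst1_le[of "fst X" "snd X"] X
    by auto
  have le: "solution_cost I1 (S, \<sigma>) \<le> 3/2 * (\<alpha> * optimum I2)"
    using solution_cost_inst1_le[OF valid] cost by argo
  have "solution_cost I1 (S, \<sigma>) \<le> 4 * \<alpha> * optimum I1"
  proof (cases "0 \<le> \<alpha>")
    case True
    then show ?thesis using le mult_left_mono[OF opt True] by argo
  next
    case False
    \<comment> \<open>A negative ratio is possible only if all costs involved vanish.\<close>
    then have "\<alpha> * optimum I2 \<le> 0" using nonneg2 by (simp add: mult_nonpos_nonneg)
    moreover have "optimum I1 \<le> solution_cost I1 (S, \<sigma>)"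
      using optimum_le[OF fin(1,2)] valid valid_inst1 by metis
    ultimately have "optimum I1 = 0" "solution_cost I1 (S, \<sigma>) = 0"
      using le nonneg1 by argo+
    then show ?thesis by simp
  qed
  then show ?thesis using valid by (auto simp: approx_solution_def valid_inst1)
qed

end

section \<open>Copying an array\<close>

text \<open>The counter \<open>''k''\<close> is initialised outside the loop, so that an induction
  can start at any counter value.\<close>

definition copy_loop :: "string \<Rightarrow> string \<Rightarrow> string \<Rightarrow> com" where
  "copy_loop n x y =
     While (NLess (NGet ''k'' (NConst 0) (NConst 0)) (NGet n (NConst 0) (NConst 0)))
       (Seq (NPut y (NGet ''k'' (NConst 0) (NConst 0)) (NConst 0)
               (NGet x (NGet ''k'' (NConst 0) (NConst 0)) (NConst 0)))
            (NPut ''k'' (NConst 0) (NConst 0)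
               (NAdd (NGet ''k'' (NConst 0) (NConst 0)) (NConst 1))))"

definition copy_array :: "string \<Rightarrow> string \<Rightarrow> string \<Rightarrow> com" where
  "copy_array n x y = Seq (NPut ''k'' (NConst 0) (NConst 0) (NConst 0)) (copy_loop n x y)"

text \<open>Induction on the number \<open>m\<close> of remaining iterations. Each costs one test
  and two assignments; the final failing test adds 1. Entries below the counter are tracked so that
  those already written are known to persist.\<close>

lemma exec_copy_loop:
  assumes "x \<noteq> y" "x \<noteq> ''k''" "y \<noteq> ''k''" "n \<noteq> y" "n \<noteq> ''k''"
    and "nmem s (''k'', 0, 0) + m = nmem s (n, 0, 0)"
  shows "\<exists>s'. exec (copy_loop n x y) s (3 * m + 1) s' \<and>
    (\<forall>i. nmem s (''k'', 0, 0) \<le> i \<longrightarrow> i < nmem s (n, 0, 0) \<longrightarrow>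
       nmem s' (y, i, 0) = nmem s (x, i, 0)) \<and>
    (\<forall>i < nmem s (''k'', 0, 0). nmem s' (y, i, 0) = nmem s (y, i, 0)) \<and>
    (\<forall>z a b. z \<noteq> y \<longrightarrow> z \<noteq> ''k'' \<longrightarrow> nmem s' (z, a, b) = nmem s (z, a, b))"
  using assms(6)
proof (induction m arbitrary: s)
  case 0
  then have "exec (copy_loop n x y) s 1 s"
    unfolding copy_loop_def by (intro WhileFalse) auto
  then show ?case using 0 by auto
next
  case (Suc m)
  define k where "k = nmem s (''k'', 0, 0)"
  define u where "u = s\<lparr>nmem := (nmem s)((y, k, 0) := nmem s (x, k, 0))\<rparr>"
  define v where "v = u\<lparr>nmem := (nmem u)((''k'', 0, 0) := Suc k)\<rparr>"
  have u_k: "nmem u (''k'', 0, 0) = k" using assms by (simp add: u_def k_def)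
  have body: "exec (Seq (NPut y (NGet ''k'' (NConst 0) (NConst 0)) (NConst 0)
               (NGet x (NGet ''k'' (NConst 0) (NConst 0)) (NConst 0)))
            (NPut ''k'' (NConst 0) (NConst 0)
               (NAdd (NGet ''k'' (NConst 0) (NConst 0)) (NConst 1)))) s (1 + 1) v"
  proof (rule exec.Seq)
    show "exec (NPut y (NGet ''k'' (NConst 0) (NConst 0)) (NConst 0)
        (NGet x (NGet ''k'' (NConst 0) (NConst 0)) (NConst 0))) s 1 u"
      using exec.NPut[of y "NGet ''k'' (NConst 0) (NConst 0)" "NConst 0"
          "NGet x (NGet ''k'' (NConst 0) (NConst 0)) (NConst 0)" s]
      by (simp add: u_def k_def)
    show "exec (NPut ''k'' (NConst 0) (NConst 0)
        (NAdd (NGet ''k'' (NConst 0) (NConst 0)) (NConst 1))) u 1 v"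
      using exec.NPut[of "''k''" "NConst 0" "NConst 0"
          "NAdd (NGet ''k'' (NConst 0) (NConst 0)) (NConst 1)" u]
      by (simp add: v_def u_k)
  qed
  have v: "nmem v (''k'', 0, 0) = Suc k" "nmem v (y, k, 0) = nmem s (x, k, 0)"
    "\<And>i. i \<noteq> k \<Longrightarrow> nmem v (y, i, 0) = nmem s (y, i, 0)"
    "\<And>z a b. z \<noteq> y \<Longrightarrow> z \<noteq> ''k'' \<Longrightarrow> nmem v (z, a, b) = nmem s (z, a, b)"
    using assms by (auto simp: v_def u_def)
  have "nmem v (''k'', 0, 0) + m = nmem v (n, 0, 0)"
    using Suc.prems v assms by (simp add: k_def)
  from Suc.IH[OF this] obtain s' where s': "exec (copy_loop n x y) v (3 * m + 1) s'"
    "\<And>i. Suc k \<le> i \<Longrightarrow> i < nmem s (n, 0, 0) \<Longrightarrow> nmem s' (y, i, 0) = nmem s (x, i, 0)"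
    "\<And>i. i < Suc k \<Longrightarrow> nmem s' (y, i, 0) = nmem v (y, i, 0)"
    "\<And>z a b. z \<noteq> y \<Longrightarrow> z \<noteq> ''k'' \<Longrightarrow> nmem s' (z, a, b) = nmem s (z, a, b)"
    using v assms by auto
  have "exec (copy_loop n x y) s (1 + (1 + 1) + (3 * m + 1)) s'"
    unfolding copy_loop_def
    by (rule WhileTrue[OF _ body s'(1)[unfolded copy_loop_def]]) (use Suc.prems in auto)
  moreover have "1 + (1 + 1) + (3 * m + 1) = 3 * Suc m + 1" by simp
  ultimately have "exec (copy_loop n x y) s (3 * Suc m + 1) s'" by metis
  \<comment> \<open>Entry \<open>k\<close> is written by this iteration and lies below the counter
    afterwards; the later ones come from the induction hypothesis.\<close>
  moreover have "nmem s' (y, i, 0) = nmem s (x, i, 0)" if "k \<le> i" "i < nmem s (n, 0, 0)" for i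
    using s'(2)[of i] s'(3)[of i] v(2) that by (cases "i = k") auto
  moreover have "nmem s' (y, i, 0) = nmem s (y, i, 0)" if "i < k" for i
    using s'(3)[of i] v(3)[of i] that by auto
  ultimately show ?case using s'(4) unfolding k_def by blast
qed

lemma exec_copy_array:
  assumes "x \<noteq> y" "x \<noteq> ''k''" "y \<noteq> ''k''" "n \<noteq> y" "n \<noteq> ''k''"
  obtains s' where "exec (copy_array n x y) s (3 * nmem s (n, 0, 0) + 2) s'"
    "\<And>i. i < nmem s (n, 0, 0) \<Longrightarrow> nmem s' (y, i, 0) = nmem s (x, i, 0)"
    "\<And>z a b. z \<noteq> y \<Longrightarrow> z \<noteq> ''k'' \<Longrightarrow> nmem s' (z, a, b) = nmem s (z, a, b)"
proof -
  define u where "u = s\<lparr>nmem := (nmem s)((''k'', 0, 0) := 0)\<rparr>"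
  have u: "nmem u (''k'', 0, 0) = 0"
    "\<And>z a b. z \<noteq> ''k'' \<Longrightarrow> nmem u (z, a, b) = nmem s (z, a, b)"
    by (auto simp: u_def)
  have init: "exec (NPut ''k'' (NConst 0) (NConst 0) (NConst 0)) s 1 u"
    using exec.NPut[of "''k''" "NConst 0" "NConst 0" "NConst 0" s] by (simp add: u_def)
  have "nmem u (''k'', 0, 0) + nmem s (n, 0, 0) = nmem u (n, 0, 0)"
    using u assms by simp
  from exec_copy_loop[OF assms this] obtain s' where
    s': "exec (copy_loop n x y) u (3 * nmem s (n, 0, 0) + 1) s'"
    "\<And>i. i < nmem s (n, 0, 0) \<Longrightarrow> nmem s' (y, i, 0) = nmem s (x, i, 0)"
    "\<And>z a b. z \<noteq> y \<Longrightarrow> z \<noteq> ''k'' \<Longrightarrow> nmem s' (z, a, b) = nmem s (z, a, b)"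
    using u assms by auto
  have "exec (copy_array n x y) s (1 + (3 * nmem s (n, 0, 0) + 1)) s'"
    unfolding copy_array_def by (rule exec.Seq[OF init s'(1)])
  with s' that show ?thesis by simp
qed

section \<open>Returning the given solution in polynomial time\<close>

theorem theorem3:
  shows "\<exists>(P :: com) (p :: nat poly).
    \<forall>(I :: ('f, 'c) lbfl) (\<beta> :: real) So \<sigma>o (\<alpha>2 :: real) S \<sigma> fs cs s.
      setting I \<beta> So \<sigma>o \<longrightarrow>
      approx_solution \<alpha>2 (inst2 I So \<sigma>o) (S, \<sigma>) \<longrightarrow>
      enumerates fs (facilities I) \<longrightarrow> enumerates cs (clients I) \<longrightarrow>
      stores_instance fs cs I s \<longrightarrow>
      stores_solution ''So'' ''sigmao'' fs cs (So, \<sigma>o) s \<longrightarrow>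
      stores_solution ''S'' ''sigma'' fs cs (S, \<sigma>) s \<longrightarrow>
      (\<exists>t s' S' \<sigma>'.
         exec P s t s' \<and>
         t \<le> poly p (card (facilities I) + card (clients I)) \<and>
         stores_solution ''Sout'' ''sigmaout'' fs cs (S', \<sigma>') s' \<and>
         approx_solution (4 * \<alpha>2) (inst1 I So \<sigma>o) (S', \<sigma>'))"
proof (rule exI[of _ "Seq (copy_array ''nF'' ''S'' ''Sout'') (copy_array ''nC'' ''sigma'' ''sigmaout'')"],
    rule exI[of _ "[:4, 3:]"], intro allI impI)
  fix I :: "('f, 'c) lbfl" and \<beta> \<alpha>2 :: real and So \<sigma>o S \<sigma> fs cs s
  assume setting: "setting I \<beta> So \<sigma>o"
    and approx: "approx_solution \<alpha>2 (inst2 I So \<sigma>o) (S, \<sigma>)"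
    and enum: "enumerates fs (facilities I)" "enumerates cs (clients I)"
    and inst: "stores_instance fs cs I s"
    and sol: "stores_solution ''S'' ''sigma'' fs cs (S, \<sigma>) s"
  interpret lbfl_setting I \<beta> So \<sigma>o by unfold_locales (rule setting)
  have len: "length fs = card F" "length cs = card C"
    using enum by (auto simp: enumerates_def distinct_card[symmetric])
  have n: "nmem s (''nF'', 0, 0) = length fs" "nmem s (''nC'', 0, 0) = length cs"
    using inst by (auto simp: stores_instance_def)
  obtain u where u: "exec (copy_array ''nF'' ''S'' ''Sout'') s (3 * length fs + 2) u"
    "\<And>i. i < length fs \<Longrightarrow> nmem u (''Sout'', i, 0) = nmem s (''S'', i, 0)"
    "\<And>z a b. z \<noteq> ''Sout'' \<Longrightarrow> z \<noteq> ''k'' \<Longrightarrow> nmem u (z, a, b) = nmem s (z, a, b)"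
    by (rule exec_copy_array[of "''S''" "''Sout''" "''nF''" s]) (auto simp: n)
  obtain s' where s': "exec (copy_array ''nC'' ''sigma'' ''sigmaout'') u (3 * length cs + 2) s'"
    "\<And>i. i < length cs \<Longrightarrow> nmem s' (''sigmaout'', i, 0) = nmem s (''sigma'', i, 0)"
    "\<And>z a b. z \<noteq> ''sigmaout'' \<Longrightarrow> z \<noteq> ''k'' \<Longrightarrow> nmem s' (z, a, b) = nmem u (z, a, b)"
    by (rule exec_copy_array[of "''sigma''" "''sigmaout''" "''nC''" u]) (auto simp: n u(3))
  \<comment> \<open>The arrays have distinct names, so the second copy leaves
    \<open>''Sout''\<close> intact.\<close>
  have "stores_solution ''Sout'' ''sigmaout'' fs cs (S, \<sigma>) s'"
    using sol u(2) s'(2,3) by (auto simp: stores_solution_def)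
  \<comment> \<open>Each copy takes 3 steps per entry plus 2, which gives slope 3 and constant term
    4.\<close>
  moreover have "(3 * length fs + 2) + (3 * length cs + 2) \<le> poly [:4, 3:] (card F + card C)"
    using len by simp
  ultimately show "\<exists>t s' S' \<sigma>'.
      exec (Seq (copy_array ''nF'' ''S'' ''Sout'') (copy_array ''nC'' ''sigma'' ''sigmaout'')) s t s' \<and>
      t \<le> poly [:4, 3:] (card F + card C) \<and>
      stores_solution ''Sout'' ''sigmaout'' fs cs (S', \<sigma>') s' \<and>
      approx_solution (4 * \<alpha>2) (inst1 I So \<sigma>o) (S', \<sigma>')"
    using exec.Seq[OF u(1) s'(1)] approx_solution_inst1[OF approx] by blast
qed

end
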